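(* Let $p=p(n)\in(0,1)$ satisfy $p\gg \log(n)/n$, and let $G\sim\mathbb{G}(n,p)$ be an Erdős–Rényi undirected random graph. Suppose there exists $\bar\alpha\in(0,1)$ such that for all $n\in\mathbb{N}$ and every $i\in[n]$ the condescendence values satisfy $\alpha_i\le\bar\alpha$. Let $x(G,\infty)$ be the stable opinion vector of the opinion dynamics on $G$ and let $\bar x(\infty)$ be the stable solution of the mean-field dynamics. Then $$\lim_{n\to\infty}\left\|\mathbf{E}\left(x(G,\infty)\right)-\bar x(\infty)\right\|_{\infty}=0.$$
   Context: Notation: $[n]=\{1,\dots,n\}$; $\log$ is the natural logarithm; for $h:\mathbb{N}\to\mathbb{R}_+$, $p\gg h$ means $p(n)/h(n)\to\infty$ as $n\to\infty$. $\mathbb{G}_n$ is the set of simple undirected graphs with node set $[n]$, and $\mathbb{G}(n,p)$ is the probability space on $\mathbb{G}_n$ in which each of the $n(n-1)/2$ possible edges is present independently with probability $p=p(n)$. $N(i)$ is the set of neighbours of $i$ in $G$ and $\deg(i)=|N(i)|$. For each $n$ there are given deterministic initial opinions $x(0)=(x_i(0))_{i\in[n]}\in[0,1]^n$ and values $\alpha_i\in[0,1]$, $i\in[n]$ (these data may depend on $n$; the bound $\bar\alpha$ does not). Opinion dynamics on $G$: $x(G,0)=x(0)$ and, for $t\ge 0$, $$x_i(G,t+1)=\begin{cases}\frac{\alpha_i}{\deg(i)}\sum_{j\in N(i)}x_j(G,t)+(1-\alpha_i)x_i(0)&\text{if }\deg(i)>0,\\ \alpha_i x_i(G,t)+(1-\alpha_i)x_i(0)&\text{if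 }\deg(i)=0.\end{cases}$$ Equivalently $x(G,t+1)=H(G)x(G,t)+Bx(0)$, where $B=\mathrm{diag}(1-\alpha_1,\dots,1-\alpha_n)$ and $H(G)\in\mathbb{R}^{n\times n}$ has entries $H_{ij}(G)=\alpha_i A_{ij}(G)/\deg(i)$ if $\deg(i)>0$ and $H_{ij}(G)=\alpha_i 1_{\{i=j\}}$ if $\deg(i)=0$, with $A(G)$ the adjacency matrix of $G$. The stable opinion vector is $x(G,\infty)=\lim_{t\to\infty}x(G,t)$, which exists when all $\alpha_i\le\bar\alpha<1$ and equals $(I-H(G))^{-1}Bx(0)$. Mean-field dynamics: $\bar x(0)=x(0)$ and $\bar x(t+1)=\mathbf{E}(H(G))^{t}x(0)+\sum_{k=0}^{t-1}\mathbf{E}(H(G))^kBx(0)$, where $\mathbf{E}(H(G))$ is the entrywise expectation for $G\sim\mathbb{G}(n,p)$. Its stable solution is $\bar x(\infty)=\lim_{t\to\infty}\bar x(t)$, which exists when all $\alpha_i\le\bar\alpha<1$ and equals $(I-\mathbf{E}(H(G)))^{-1}Bx(0)$. *)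

theory Defs
  imports "HOL-Probability.Probability" "Jordan_Normal_Form.Matrix"
begin

hide_type (open) Finite_Cartesian_Product.vec
hide_const (open) Finite_Cartesian_Product.vec Finite_Cartesian_Product.mat
unbundle no vec_syntax

text \<open>
  The node set is \<open>{0..<n}\<close> instead of \<open>{1..n}\<close>, in line with the indexing of vectors and
  matrices. A simple undirected graph on it is identified with its edge set, a subset of
  \<open>possible_edges n\<close>.
\<close>

type_synonym graph = "nat set set"

definition possible_edges :: "nat \<Rightarrow> nat set set" where
  "possible_edges n = {{i, j} | i j. i < n \<and> j < n \<and> i \<noteq> j}"

definition erdos_renyi :: "nat \<Rightarrow> real \<Rightarrow> graph pmf" where
  "erdos_renyi n p =
     map_pmf (\<lambda>b. {e \<in> possible_edges n. b e})
       (Pi_pmf (possible_edges n) False (\<lambda>_. bernoulli_pmf p))"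

definition neighbours :: "graph \<Rightarrow> nat \<Rightarrow> nat set" where
  "neighbours G i = {j. {i, j} \<in> G}"

definition node_degree :: "graph \<Rightarrow> nat \<Rightarrow> nat" where
  "node_degree G i = card (neighbours G i)"

definition adjacency :: "nat \<Rightarrow> graph \<Rightarrow> real mat" where
  "adjacency n G = mat n n (\<lambda>(i, j). if {i, j} \<in> G then 1 else 0)"

text \<open>In the following, \<open>\<alpha> i\<close> is only relevant for \<open>i < n\<close>, and \<open>x0\<close> is meant to be in
  \<open>carrier_vec n\<close>.\<close>

primrec opinion :: "nat \<Rightarrow> (nat \<Rightarrow> real) \<Rightarrow> real vec \<Rightarrow> graph \<Rightarrow> nat \<Rightarrow> real vec" where
  "opinion n \<alpha> x0 G 0 = x0"
| "opinion n \<alpha> x0 G (Suc t) = vec n (\<lambda>i.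
     if node_degree G i > 0
     then \<alpha> i / real (node_degree G i) * (\<Sum>j\<in>neighbours G i. opinion n \<alpha> x0 G t $ j)
            + (1 - \<alpha> i) * x0 $ i
     else \<alpha> i * opinion n \<alpha> x0 G t $ i + (1 - \<alpha> i) * x0 $ i)"

text \<open>Limits of vectors are taken componentwise; they exist if \<open>\<alpha>\<close> is bounded
  by a constant less than 1.\<close>

definition stable_opinion :: "nat \<Rightarrow> (nat \<Rightarrow> real) \<Rightarrow> real vec \<Rightarrow> graph \<Rightarrow> real vec" where
  "stable_opinion n \<alpha> x0 G = vec n (\<lambda>i. lim (\<lambda>t. opinion n \<alpha> x0 G t $ i))"

definition expected_stable_opinion ::
    "nat \<Rightarrow> real \<Rightarrow> (nat \<Rightarrow> real) \<Rightarrow> real vec \<Rightarrow> real vec" where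
  "expected_stable_opinion n p \<alpha> x0 = vec n (\<lambda>i.
     measure_pmf.expectation (erdos_renyi n p) (\<lambda>G. stable_opinion n \<alpha> x0 G $ i))"

definition H_mat :: "nat \<Rightarrow> (nat \<Rightarrow> real) \<Rightarrow> graph \<Rightarrow> real mat" where
  "H_mat n \<alpha> G = mat n n (\<lambda>(i, j).
     if node_degree G i > 0 then \<alpha> i * adjacency n G $$ (i, j) / real (node_degree G i)
     else if i = j then \<alpha> i else 0)"

definition B_mat :: "nat \<Rightarrow> (nat \<Rightarrow> real) \<Rightarrow> real mat" where
  "B_mat n \<alpha> = mat_diag n (\<lambda>i. 1 - \<alpha> i)"

definition expected_H :: "nat \<Rightarrow> real \<Rightarrow> (nat \<Rightarrow> real) \<Rightarrow> real mat" where
  "expected_H n p \<alpha> = mat n n (\<lambda>(i, j).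
     measure_pmf.expectation (erdos_renyi n p) (\<lambda>G. H_mat n \<alpha> G $$ (i, j)))"

text \<open>At time \<open>t + 1\<close> the powers go up to \<open>t\<close>, not \<open>t + 1\<close>: this is the paper's
  indexing. The limit does not depend on this shift.\<close>

primrec mean_field :: "nat \<Rightarrow> real \<Rightarrow> (nat \<Rightarrow> real) \<Rightarrow> real vec \<Rightarrow> nat \<Rightarrow> real vec" where
  "mean_field n p \<alpha> x0 0 = x0"
| "mean_field n p \<alpha> x0 (Suc t) = vec n (\<lambda>i.
     (expected_H n p \<alpha> ^\<^sub>m t *\<^sub>v x0) $ i
     + (\<Sum>k<t. (expected_H n p \<alpha> ^\<^sub>m k *\<^sub>v (B_mat n \<alpha> *\<^sub>v x0)) $ i))"

definition stable_mean_field ::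
    "nat \<Rightarrow> real \<Rightarrow> (nat \<Rightarrow> real) \<Rightarrow> real vec \<Rightarrow> real vec" where
  "stable_mean_field n p \<alpha> x0 = vec n (\<lambda>i. lim (\<lambda>t. mean_field n p \<alpha> x0 t $ i))"

text \<open>Inserting 0 only matters for the empty vector.\<close>

definition linf_norm :: "real vec \<Rightarrow> real" where
  "linf_norm v = Max (insert 0 ((\<lambda>i. \<bar>v $ i\<bar>) ` {..<dim_vec v}))"

end

theory Submission
  imports Defs
begin

text \<open>
  Let \<open>y\<close> be the mean-field solution, \<open>x\<close> the stable opinion vector, \<open>H = H(G)\<close> and \<open>Q = E H\<close>.
  From \<open>x = H x + b\<close> and \<open>y = Q y + b\<close> one gets \<open>x - y = H (x - y) + (H - Q) y\<close>, so that
  \<open>\<parallel>x - y\<parallel> \<le> \<parallel>(H - Q) y\<parallel> / (1 - \<alpha>bar)\<close> in the maximum norm. As \<open>y\<close> is deterministic, a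
  Chernoff bound shows that every \<open>(H y) i\<close> is close to \<open>\<alpha> i\<close> times the average of \<open>y\<close> over the
  nodes other than \<open>i\<close>, outside an event of probability at most \<open>4 / n\<close>; this is where
  \<open>p \<gg> log n / n\<close> enters. Taking expectations, \<open>(Q y) i\<close> is close to the same number.
\<close>

subsection \<open>Affine iterations with a substochastic matrix\<close>

text \<open>The box [0,1] is invariant, since a row of \<open>K\<close> contributes at most
  \<open>a i\<close> and \<open>b i\<close> at most \<open>1 - a i\<close>. Successive differences
  shrink by the factor \<open>c\<close> per step, so the telescoping series of increments is
  dominated by a geometric one; the limit then passes through the finite sums. Both the opinion
  dynamics and the mean-field dynamics are instances.\<close>

lemma affine_iteration_converges:
  fixes K :: "nat \<Rightarrow> nat \<Rightarrow> real" and a b :: "nat \<Rightarrow> real" and u :: "nat \<Rightarrow> nat \<Rightarrow> real"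
  assumes K: "\<And>i j. i < n \<Longrightarrow> j < n \<Longrightarrow> 0 \<le> K i j"
    and row: "\<And>i. i < n \<Longrightarrow> (\<Sum>j<n. K i j) = a i"
    and a: "\<And>i. i < n \<Longrightarrow> a i \<le> c" and c: "0 \<le> c" "c < 1"
    and b: "\<And>i. i < n \<Longrightarrow> 0 \<le> b i \<and> b i \<le> 1 - a i"
    and u0: "\<And>i. i < n \<Longrightarrow> 0 \<le> u 0 i \<and> u 0 i \<le> 1"
    and rec: "\<And>t i. i < n \<Longrightarrow> u (Suc t) i = (\<Sum>j<n. K i j * u t j) + b i"
  shows "\<exists>y. \<forall>i<n. (\<lambda>t. u t i) \<longlonglongrightarrow> y i \<and> 0 \<le> y i \<and> y i \<le> 1
    \<and> y i = (\<Sum>j<n. K i j * y j) + b i"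
proof -
  have u01: "0 \<le> u t i \<and> u t i \<le> 1" if "i < n" for t i
    using that
  proof (induction t arbitrary: i)
    case 0
    then show ?case by (rule u0)
  next
    case (Suc t)
    have "0 \<le> (\<Sum>j<n. K i j * u t j)"
      using Suc K by (intro sum_nonneg) auto
    moreover have "(\<Sum>j<n. K i j * u t j) \<le> (\<Sum>j<n. K i j)"
      using Suc K by (intro sum_mono mult_left_le) auto
    ultimately show ?case
      using Suc.prems b[of i] row[of i] by (simp add: rec)
  qed
  have step: "\<bar>u (Suc t) i - u t i\<bar> \<le> c ^ t" if "i < n" for t i
    using that
  proof (induction t arbitrary: i)
    case 0
    then show ?case using u01[of i 0] u01[of i "Suc 0"] by (simp add: abs_le_iff)
  next
    case (Suc t)
    have "u (Suc (Suc t)) i - u (Suc t) i = (\<Sum>j<n. K i j * (u (Suc t) j - u t j))"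
      unfolding rec[OF Suc.prems, of "Suc t"] rec[OF Suc.prems, of t]
      by (simp add: right_diff_distrib sum_subtractf)
    also have "\<bar>\<dots>\<bar> \<le> (\<Sum>j<n. K i j * c ^ t)"
      using Suc K by (intro order_trans[OF sum_abs] sum_mono) (auto simp: abs_mult intro!: mult_left_mono)
    also have "\<dots> = a i * c ^ t"
      using Suc.prems by (simp add: row flip: sum_distrib_right)
    also have "\<dots> \<le> c ^ Suc t"
      using a[OF Suc.prems] c by (simp add: mult_right_mono)
    finally show ?case .
  qed
  have "\<exists>l. (\<lambda>t. u t i) \<longlonglongrightarrow> l" if "i < n" for i
  proof -
    have "summable (\<lambda>t. u (Suc t) i - u t i)"
      by (rule summable_comparison_test'[of "\<lambda>t. c ^ t" 0])
        (use c step[OF that] in \<open>auto intro: summable_geometric\<close>)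
    then have "(\<lambda>t. \<Sum>s<t. u (Suc s) i - u s i) \<longlonglongrightarrow> (\<Sum>s. u (Suc s) i - u s i)"
      by (rule summable_LIMSEQ)
    then have "(\<lambda>t. u t i - u 0 i) \<longlonglongrightarrow> (\<Sum>s. u (Suc s) i - u s i)"
      unfolding sum_lessThan_telescope[of "\<lambda>t. u t i"] .
    from tendsto_add[OF this tendsto_const[of "u 0 i"]] show ?thesis by auto
  qed
  then obtain y where y: "\<And>i. i < n \<Longrightarrow> (\<lambda>t. u t i) \<longlonglongrightarrow> y i" by metis
  show ?thesis
  proof (intro exI[of _ y] allI impI conjI)
    fix i assume i: "i < n"
    show "(\<lambda>t. u t i) \<longlonglongrightarrow> y i" by (rule y[OF i])
    show "0 \<le> y i" "y i \<le> 1"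
      using LIMSEQ_le_const[OF y[OF i], of 0] LIMSEQ_le_const2[OF y[OF i], of 1] u01[OF i] by auto
    have "(\<lambda>t. u (Suc t) i) \<longlonglongrightarrow> (\<Sum>j<n. K i j * y j) + b i"
      unfolding rec[OF i] by (intro tendsto_intros) (simp add: y)
    with LIMSEQ_Suc[OF y[OF i]] show "y i = (\<Sum>j<n. K i j * y j) + b i"
      by (rule LIMSEQ_unique)
  qed
qed

text \<open>At an index where \<open>\<bar>x k - y k\<bar>\<close> equals its maximum
  \<open>M\<close>, subtracting the two equations gives \<open>M \<le> c * M + \<delta>\<close>. The
  matrices are compared only through their action on the single vector \<open>y\<close>, which is
  far weaker than closeness in norm.\<close>

lemma affine_fixed_points_close:
  fixes K L :: "nat \<Rightarrow> nat \<Rightarrow> real" and a b x y :: "nat \<Rightarrow> real"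
  assumes K: "\<And>i j. i < n \<Longrightarrow> j < n \<Longrightarrow> 0 \<le> K i j"
    and row: "\<And>i. i < n \<Longrightarrow> (\<Sum>j<n. K i j) \<le> c" and c: "c < 1"
    and x: "\<And>i. i < n \<Longrightarrow> x i = (\<Sum>j<n. K i j * x j) + b i"
    and y: "\<And>i. i < n \<Longrightarrow> y i = (\<Sum>j<n. L i j * y j) + b i"
    and \<delta>: "\<And>i. i < n \<Longrightarrow> \<bar>(\<Sum>j<n. K i j * y j) - (\<Sum>j<n. L i j * y j)\<bar> \<le> \<delta>"
    and i: "i < n"
  shows "\<bar>x i - y i\<bar> \<le> \<delta> / (1 - c)"
proof -
  let ?M = "Max ((\<lambda>i. \<bar>x i - y i\<bar>) ` {..<n})"
  have le: "\<bar>x i - y i\<bar> \<le> ?M" if "i < n" for i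
    using that by (intro Max_ge) auto
  \<comment> \<open>The maximum is attained because the index set contains \<open>i\<close> and so
    is nonempty.\<close>
  have "?M \<in> (\<lambda>i. \<bar>x i - y i\<bar>) ` {..<n}"
    using i by (intro Max_in) auto
  then obtain k where k: "k < n" "?M = \<bar>x k - y k\<bar>" by auto
  have "x k - y k = (\<Sum>j<n. K k j * (x j - y j)) + ((\<Sum>j<n. K k j * y j) - (\<Sum>j<n. L k j * y j))"
    using x[OF k(1)] y[OF k(1)] by (simp add: right_diff_distrib sum_subtractf)
  moreover have "\<bar>\<Sum>j<n. K k j * (x j - y j)\<bar> \<le> c * ?M"
  proof -
    have "\<bar>\<Sum>j<n. K k j * (x j - y j)\<bar> \<le> (\<Sum>j<n. K k j * ?M)"
      using K k le by (intro order_trans[OF sum_abs] sum_mono) (auto simp: abs_mult intro!: mult_left_mono)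
    also have "\<dots> = (\<Sum>j<n. K k j) * ?M" by (simp add: sum_distrib_right)
    also have "\<dots> \<le> c * ?M"
      using row[OF k(1)] k(2) by (intro mult_right_mono) auto
    finally show ?thesis .
  qed
  ultimately have "?M \<le> c * ?M + \<delta>"
    using \<delta>[OF k(1)] k(2) by linarith
  then have "?M \<le> \<delta> / (1 - c)" using c by (simp add: field_simps)
  with le[OF i] show ?thesis by linarith
qed

subsection \<open>Random graphs\<close>

lemma finite_possible_edges [simp]: "finite (possible_edges n)"
proof -
  have "possible_edges n \<subseteq> Pow {..<n}" by (auto simp: possible_edges_def)
  then show ?thesis by (rule finite_subset) simp
qed

lemma set_erdos_renyi_subset: "set_pmf (erdos_renyi n p) \<subseteq> Pow (possible_edges n)"
  by (auto simp: erdos_renyi_def)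

lemma finite_set_erdos_renyi: "finite (set_pmf (erdos_renyi n p))"
  by (rule finite_subset[OF set_erdos_renyi_subset]) simp

lemma integrable_erdos_renyi [simp]: "integrable (erdos_renyi n p) (f :: graph \<Rightarrow> real)"
  by (rule integrable_measure_pmf_finite[OF finite_set_erdos_renyi])

lemma neighbours_eq:
  assumes "G \<subseteq> possible_edges n"
  shows "neighbours G i = {j. j < n \<and> {i, j} \<in> G}"
  using assms by (fastforce simp: neighbours_def possible_edges_def doubleton_eq_iff)

section \<open>Exponential moments and Chernoff bounds for sums over neighbourhoods\<close>

text \<open>For negative \<open>x = - t\<close> the bound follows from
  \<open>exp t \<ge> 1 + t\<close> and the identity (1 - t + t^2)(1 + t) = 1 + t^3. It provides the
  second-order estimate of the moment generating function.\<close>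

lemma exp_le_quadratic:
  fixes x :: real
  assumes "\<bar>x\<bar> \<le> 1"
  shows "exp x \<le> 1 + x + x\<^sup>2"
proof (cases "0 \<le> x")
  case True
  with assms show ?thesis by (intro exp_bound) auto
next
  case False
  define t where "t = - x"
  have t: "0 < t" "t \<le> 1" using False assms by (auto simp: t_def)
  have "1 \<le> (1 - t + t\<^sup>2) * (1 + t)"
    using t by (simp add: algebra_simps power2_eq_square)
  also have "\<dots> \<le> (1 - t + t\<^sup>2) * exp t"
    using t exp_ge_add_one_self[of t] by (intro mult_left_mono) auto
  finally have "exp (- t) \<le> 1 - t + t\<^sup>2" by (simp add: exp_minus field_simps)
  then show ?thesis by (simp add: t_def)
qed

text \<open>The exponential of the sum is a product over all possible edges, with factor 1 for edges
  that avoid \<open>i\<close> or are absent. Independence turns the expectation into a product of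
  Bernoulli expectations.\<close>

lemma erdos_renyi_exp_moment:
  fixes u :: "nat \<Rightarrow> real"
  assumes p: "0 \<le> p" "p \<le> 1" and i: "i < n"
    and u: "\<And>j. j < n \<Longrightarrow> \<bar>u j\<bar> \<le> 1"
  shows "measure_pmf.expectation (erdos_renyi n p) (\<lambda>G. exp (\<Sum>j\<in>neighbours G i. u j))
    = (\<Prod>j\<in>{..<n} - {i}. 1 + p * (exp (u j) - 1))"
proof -
  let ?E = "possible_edges n" and ?J = "{..<n} - {i}"
  let ?Ei = "(\<lambda>j. {i, j}) ` ?J"
  \<comment> \<open>\<open>w\<close> reads the weight of an edge at \<open>i\<close> from its other
    endpoint, so that factors can be indexed by edges, the coordinates of
    \<open>Pi_pmf\<close>.\<close>
  define w where "w e = u (the_elem (e - {i}))" for e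
  have w: "w {i, j} = u j" if "j \<noteq> i" for j
  proof -
    have "{i, j} - {i} = {j}" using that by auto
    then show ?thesis by (simp add: w_def)
  qed
  have inj: "inj_on (\<lambda>j. {i, j}) ?J" by (auto simp: inj_on_def doubleton_eq_iff)
  have sub: "?Ei \<subseteq> ?E" using i by (auto simp: possible_edges_def)
  define f where "f e b = (if e \<in> ?Ei \<and> b then exp (w e) else 1)" for e b
  \<comment> \<open>Used twice: for the random factors, and again for their expectations after
    independence has been applied.\<close>
  have split: "(\<Prod>e\<in>?E. g e) = (\<Prod>j\<in>?J. g {i, j})" if "\<And>e. e \<in> ?E - ?Ei \<Longrightarrow> g e = 1"
    for g :: "nat set \<Rightarrow> real"
    using that inj sub by (subst prod.mono_neutral_right[of ?E ?Ei]) (auto simp: prod.reindex)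
  have sum_eq: "exp (\<Sum>j\<in>neighbours {e \<in> ?E. b e} i. u j) = (\<Prod>e\<in>?E. f e (b e))" for b
  proof -
    have "(\<Prod>e\<in>?E. f e (b e)) = (\<Prod>j\<in>?J. f {i, j} (b {i, j}))"
      by (rule split) (auto simp: f_def)
    also have "\<dots> = (\<Prod>j\<in>?J. if b {i, j} then exp (u j) else 1)"
      by (intro prod.cong) (auto simp: f_def w)
    also have "\<dots> = (\<Prod>j\<in>{j\<in>?J. b {i, j}}. exp (u j))"
      by (simp add: prod.If_cases Int_def)
    also have "{j\<in>?J. b {i, j}} = neighbours {e \<in> ?E. b e} i"
      using i by (subst neighbours_eq[of _ n]) (auto simp: possible_edges_def doubleton_eq_iff)
    finally show ?thesis by (simp add: exp_sum neighbours_eq[of _ n])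
  qed
  have "measure_pmf.expectation (erdos_renyi n p) (\<lambda>G. exp (\<Sum>j\<in>neighbours G i. u j))
     = measure_pmf.expectation (Pi_pmf ?E False (\<lambda>_. bernoulli_pmf p)) (\<lambda>b. \<Prod>e\<in>?E. f e (b e))"
    by (simp add: erdos_renyi_def sum_eq)
  also have "\<dots> = (\<Prod>e\<in>?E. measure_pmf.expectation (bernoulli_pmf p) (f e))"
    by (rule expectation_prod_Pi_pmf) (auto simp: f_def intro!: integrable_measure_pmf_finite)
  also have "\<dots> = (\<Prod>e\<in>?E. f e True * p + f e False * (1 - p))"
    using p by simp
  also have "\<dots> = (\<Prod>j\<in>?J. f {i, j} True * p + f {i, j} False * (1 - p))"
    by (rule split) (auto simp: f_def)
  also have "\<dots> = (\<Prod>j\<in>?J. 1 + p * (exp (u j) - 1))"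
    by (intro prod.cong) (auto simp: f_def w algebra_simps)
  finally show ?thesis .
qed

text \<open>Exponential Markov inequality. With \<open>M = real (n - 1) * p\<close> and parameter
  \<open>l\<close>, the exponent is at most M (l^2 - \<epsilon> l), where l^2 comes from bounding
  the square of each \<open>l * u j\<close>.\<close>

lemma erdos_renyi_upper_tail:
  fixes u :: "nat \<Rightarrow> real"
  assumes p: "0 \<le> p" "p \<le> 1" and i: "i < n"
    and u: "\<And>j. j < n \<Longrightarrow> \<bar>u j\<bar> \<le> 1"
    and \<epsilon>: "0 < \<epsilon>" "\<epsilon> \<le> 2"
  shows "measure_pmf.prob (erdos_renyi n p)
      {G. (\<Sum>j\<in>neighbours G i. u j) - p * (\<Sum>j\<in>{..<n} - {i}. u j) \<ge> \<epsilon> * (real (n - 1) * p)}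
    \<le> exp (- \<epsilon>\<^sup>2 * (real (n - 1) * p) / 4)"
proof -
  let ?J = "{..<n} - {i}" and ?M = "real (n - 1) * p"
  let ?f = "\<lambda>G. \<Sum>j\<in>neighbours G i. u j" and ?s = "\<Sum>j\<in>?J. u j"
  \<comment> \<open>This value minimises l^2 - \<epsilon> l, with minimum -\<epsilon>^2 / 4. The
    bound \<open>\<epsilon> \<le> 2\<close> keeps \<open>l \<le> 1\<close>, as
    \<open>exp_le_quadratic\<close> requires of \<open>l * u j\<close>.\<close>
  define l where "l = \<epsilon> / 2"
  have l: "0 < l" "l \<le> 1" using \<epsilon> by (auto simp: l_def)
  have lu: "\<bar>l * u j\<bar> \<le> 1" if "j < n" for j
    using l u[OF that] by (auto simp: abs_mult intro: mult_le_one)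
  have bound: "1 + p * (exp (l * u j) - 1) \<le> exp (p * (l * u j + l\<^sup>2))" if "j < n" for j
  proof -
    have "(l * u j)\<^sup>2 \<le> l\<^sup>2"
      using l u[OF that] by (intro abs_le_square_iff[THEN iffD1]) (auto simp: abs_mult intro: mult_left_le)
    then have "exp (l * u j) - 1 \<le> l * u j + l\<^sup>2"
      using exp_le_quadratic[OF lu[OF that]] by linarith
    then have "1 + p * (exp (l * u j) - 1) \<le> 1 + p * (l * u j + l\<^sup>2)"
      using p by (intro add_left_mono mult_left_mono) auto
    also have "\<dots> \<le> exp (p * (l * u j + l\<^sup>2))" by (rule exp_ge_add_one_self)
    finally show ?thesis .
  qed
  \<comment> \<open>Each factor is a convex combination of 1 and \<open>exp z\<close>; the
    nonnegativity is needed to compare products factor by factor.\<close>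
  have nonneg: "0 \<le> 1 + p * (exp z - 1)" for z
  proof -
    have "0 \<le> (1 - p) + p * exp z" using p by simp
    then show ?thesis by (simp add: algebra_simps)
  qed
  have "measure_pmf.expectation (erdos_renyi n p) (\<lambda>G. exp (l * ?f G))
      = (\<Prod>j\<in>?J. 1 + p * (exp (l * u j) - 1))"
    unfolding sum_distrib_left using p i lu by (rule erdos_renyi_exp_moment)
  also have "\<dots> \<le> (\<Prod>j\<in>?J. exp (p * (l * u j + l\<^sup>2)))"
    by (intro prod_mono) (auto simp: bound nonneg)
  also have "\<dots> = exp (\<Sum>j\<in>?J. p * (l * u j + l\<^sup>2))" by (simp add: exp_sum)
  also have "(\<Sum>j\<in>?J. p * (l * u j + l\<^sup>2)) = p * l * ?s + ?M * l\<^sup>2"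
    using i by (simp add: algebra_simps sum.distrib sum_distrib_left sum_distrib_right)
  finally have mgf: "measure_pmf.expectation (erdos_renyi n p) (\<lambda>G. exp (l * ?f G))
      \<le> exp (p * l * ?s + ?M * l\<^sup>2)" .
  let ?c = "exp (l * (p * ?s + \<epsilon> * ?M))"
  have "{G. ?f G - p * ?s \<ge> \<epsilon> * ?M} = {G. exp (l * ?f G) \<ge> ?c}"
    using l by auto
  then have "measure_pmf.prob (erdos_renyi n p) {G. ?f G - p * ?s \<ge> \<epsilon> * ?M}
      \<le> measure_pmf.expectation (erdos_renyi n p) (\<lambda>G. exp (l * ?f G)) / ?c"
    using integral_Markov_inequality_measure[of "erdos_renyi n p" "\<lambda>G. exp (l * ?f G)" "{}" ?c]
    by simp
  also have "\<dots> \<le> exp (p * l * ?s + ?M * l\<^sup>2) / ?c"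
    using mgf by (intro divide_right_mono) auto
  also have "\<dots> = exp (- \<epsilon>\<^sup>2 * ?M / 4)"
    unfolding exp_diff[symmetric] by (simp add: l_def field_simps power2_eq_square)
  finally show ?thesis .
qed

text \<open>The lower tail is the upper tail of \<open>- u\<close>; a union bound accounts for the
  factor 2.\<close>

lemma erdos_renyi_concentration:
  fixes u :: "nat \<Rightarrow> real"
  assumes p: "0 \<le> p" "p \<le> 1" and i: "i < n"
    and u: "\<And>j. j < n \<Longrightarrow> \<bar>u j\<bar> \<le> 1"
    and \<epsilon>: "0 < \<epsilon>" "\<epsilon> \<le> 2"
  shows "measure_pmf.prob (erdos_renyi n p)
      {G. \<bar>(\<Sum>j\<in>neighbours G i. u j) - p * (\<Sum>j\<in>{..<n} - {i}. u j)\<bar> \<ge> \<epsilon> * (real (n - 1) * p)}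
    \<le> 2 * exp (- \<epsilon>\<^sup>2 * (real (n - 1) * p) / 4)" (is "measure_pmf.prob ?P ?A \<le> 2 * ?e")
proof -
  let ?B = "\<lambda>u. {G. (\<Sum>j\<in>neighbours G i. u j) - p * (\<Sum>j\<in>{..<n} - {i}. u j) \<ge> \<epsilon> * (real (n - 1) * p)}"
  have "?A \<subseteq> ?B u \<union> ?B (\<lambda>j. - u j)" by (auto simp: sum_negf abs_if split: if_splits)
  then have "measure_pmf.prob ?P ?A \<le> measure_pmf.prob ?P (?B u \<union> ?B (\<lambda>j. - u j))"
    by (intro measure_pmf.finite_measure_mono) auto
  also have "\<dots> \<le> measure_pmf.prob ?P (?B u) + measure_pmf.prob ?P (?B (\<lambda>j. - u j))"
    by (rule measure_Un_le) auto
  also have "\<dots> \<le> ?e + ?e"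
    using p i u \<epsilon> by (intro add_mono erdos_renyi_upper_tail) auto
  finally show ?thesis by simp
qed

text \<open>Pointwise on the support, \<open>\<bar>X\<bar>\<close> is at most \<open>a\<close> plus
  the indicator of \<open>Bad\<close>.\<close>

lemma abs_expectation_le_bad_event:
  fixes X :: "'a \<Rightarrow> real"
  assumes fin: "finite (set_pmf P)" and a: "0 \<le> a"
    and le1: "\<And>G. G \<in> set_pmf P \<Longrightarrow> \<bar>X G\<bar> \<le> 1"
    and le: "\<And>G. G \<in> set_pmf P \<Longrightarrow> G \<notin> Bad \<Longrightarrow> \<bar>X G\<bar> \<le> a"
  shows "\<bar>measure_pmf.expectation P X\<bar> \<le> a + measure_pmf.prob P Bad"
proof -
  have [simp]: "integrable P f" for f :: "'a \<Rightarrow> real"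
    by (rule integrable_measure_pmf_finite[OF fin])
  have "\<bar>measure_pmf.expectation P X\<bar> \<le> measure_pmf.expectation P (\<lambda>G. \<bar>X G\<bar>)"
    by (rule integral_abs_bound)
  also have "\<dots> \<le> measure_pmf.expectation P (\<lambda>G. a + indicator Bad G)"
  proof (rule integral_mono_AE)
    have "\<bar>X G\<bar> \<le> a + indicator Bad G" if "G \<in> set_pmf P" for G
      using le1[OF that] le[OF that] a by (cases "G \<in> Bad") auto
    then show "AE G in P. \<bar>X G\<bar> \<le> a + indicator Bad G"
      by (simp add: AE_measure_pmf_iff)
  qed auto
  also have "\<dots> = a + measure_pmf.prob P Bad" by simp
  finally show ?thesis .
qed

subsection \<open>The averaging matrix\<close>

lemma H_mat_nonneg:
  assumes "i < n" "j < n" "0 \<le> \<alpha> i"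
  shows "0 \<le> H_mat n \<alpha> G $$ (i, j)"
  using assms by (auto simp: H_mat_def adjacency_def)

text \<open>Rewrites a row of the matrix as the case distinction on the degree in the recursion of
  \<open>opinion\<close>, which also exposes the neighbourhood sums to the concentration
  bounds.\<close>

lemma H_mat_sum:
  assumes G: "G \<subseteq> possible_edges n" and i: "i < n"
  shows "(\<Sum>j<n. H_mat n \<alpha> G $$ (i, j) * v j) =
    (if node_degree G i > 0 then \<alpha> i / real (node_degree G i) * (\<Sum>j\<in>neighbours G i. v j)
     else \<alpha> i * v i)"
proof (cases "node_degree G i > 0")
  case True
  have "(\<Sum>j<n. H_mat n \<alpha> G $$ (i, j) * v j)
      = (\<Sum>j<n. if {i, j} \<in> G then \<alpha> i / real (node_degree G i) * v j else 0)"
    using True i by (intro sum.cong) (auto simp: H_mat_def adjacency_def)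
  also have "\<dots> = (\<Sum>j\<in>neighbours G i. \<alpha> i / real (node_degree G i) * v j)"
    by (simp add: neighbours_eq[OF G] sum.If_cases Int_def)
  finally show ?thesis using True by (simp add: sum_distrib_left)
next
  case False
  have "(\<Sum>j<n. H_mat n \<alpha> G $$ (i, j) * v j) = (\<Sum>j<n. if i = j then \<alpha> i * v j else 0)"
    using False i by (intro sum.cong) (auto simp: H_mat_def)
  then show ?thesis using False i by simp
qed

text \<open>Apply the matrix to the constant vector 1. The diagonal entry of an isolated node makes
  this hold for every graph, hence also for the expected matrix.\<close>

lemma H_mat_row_sum:
  assumes "G \<subseteq> possible_edges n" "i < n"
  shows "(\<Sum>j<n. H_mat n \<alpha> G $$ (i, j)) = \<alpha> i"
  using H_mat_sum[OF assms, of \<alpha> "\<lambda>_. 1"] by (auto simp: node_degree_def)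

lemma H_mat_sum_bounds:
  assumes G: "G \<subseteq> possible_edges n" and i: "i < n" and \<alpha>: "0 \<le> \<alpha> i" "\<alpha> i \<le> 1"
    and v: "\<And>j. j < n \<Longrightarrow> 0 \<le> v j \<and> v j \<le> (1 :: real)"
  shows "0 \<le> (\<Sum>j<n. H_mat n \<alpha> G $$ (i, j) * v j)"
    and "(\<Sum>j<n. H_mat n \<alpha> G $$ (i, j) * v j) \<le> 1"
proof -
  show "0 \<le> (\<Sum>j<n. H_mat n \<alpha> G $$ (i, j) * v j)"
    using i \<alpha> v by (intro sum_nonneg mult_nonneg_nonneg H_mat_nonneg) auto
  have "(\<Sum>j<n. H_mat n \<alpha> G $$ (i, j) * v j) \<le> (\<Sum>j<n. H_mat n \<alpha> G $$ (i, j))"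
    using i \<alpha> v by (intro sum_mono mult_left_le H_mat_nonneg) auto
  then show "(\<Sum>j<n. H_mat n \<alpha> G $$ (i, j) * v j) \<le> 1"
    using \<alpha> H_mat_row_sum[OF G i, of \<alpha>] by simp
qed

lemma expected_H_sum:
  assumes "i < n"
  shows "(\<Sum>j<n. expected_H n p \<alpha> $$ (i, j) * v j)
    = measure_pmf.expectation (erdos_renyi n p) (\<lambda>G. \<Sum>j<n. H_mat n \<alpha> G $$ (i, j) * v j)"
  using assms by (simp add: expected_H_def)

lemma expected_H_nonneg:
  assumes "i < n" "j < n" "0 \<le> \<alpha> i"
  shows "0 \<le> expected_H n p \<alpha> $$ (i, j)"
  using assms by (simp add: expected_H_def H_mat_nonneg)

lemma expected_H_row_sum:
  assumes i: "i < n"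
  shows "(\<Sum>j<n. expected_H n p \<alpha> $$ (i, j)) = \<alpha> i"
proof -
  have "(\<Sum>j<n. expected_H n p \<alpha> $$ (i, j))
      = measure_pmf.expectation (erdos_renyi n p) (\<lambda>G. \<Sum>j<n. H_mat n \<alpha> G $$ (i, j))"
    using expected_H_sum[OF i, of p \<alpha> "\<lambda>_. 1"] by simp
  also have "\<dots> = measure_pmf.expectation (erdos_renyi n p) (\<lambda>G. \<alpha> i)"
    using H_mat_row_sum[OF _ i] set_erdos_renyi_subset[of n p]
    by (intro integral_cong_AE) (auto simp: AE_measure_pmf_iff)
  finally show ?thesis by simp
qed

section \<open>The two stable vectors as fixed points\<close>

lemma stable_opinion_fixed_point:
  assumes G: "G \<subseteq> possible_edges n" and c: "0 \<le> c" "c < 1"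
    and \<alpha>: "\<And>i. i < n \<Longrightarrow> 0 \<le> \<alpha> i \<and> \<alpha> i \<le> c"
    and x0: "\<And>i. i < n \<Longrightarrow> 0 \<le> x0 $ i \<and> x0 $ i \<le> 1"
    and i: "i < n"
  shows "0 \<le> stable_opinion n \<alpha> x0 G $ i \<and> stable_opinion n \<alpha> x0 G $ i \<le> 1"
    and "stable_opinion n \<alpha> x0 G $ i =
      (\<Sum>j<n. H_mat n \<alpha> G $$ (i, j) * stable_opinion n \<alpha> x0 G $ j) + (1 - \<alpha> i) * x0 $ i"
proof -
  have "\<exists>y. \<forall>i<n. (\<lambda>t. opinion n \<alpha> x0 G t $ i) \<longlonglongrightarrow> y i \<and> 0 \<le> y i \<and> y i \<le> 1
      \<and> y i = (\<Sum>j<n. H_mat n \<alpha> G $$ (i, j) * y j) + (1 - \<alpha> i) * x0 $ i"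
  proof (rule affine_iteration_converges[where n = n and K = "\<lambda>i j. H_mat n \<alpha> G $$ (i, j)"
        and a = \<alpha> and b = "\<lambda>i. (1 - \<alpha> i) * x0 $ i" and c = c
        and u = "\<lambda>t i. opinion n \<alpha> x0 G t $ i"])
    fix i assume i: "i < n"
    show "0 \<le> (1 - \<alpha> i) * x0 $ i \<and> (1 - \<alpha> i) * x0 $ i \<le> 1 - \<alpha> i"
      using \<alpha>[OF i] x0[OF i] c by (auto intro: mult_left_le)
    show "opinion n \<alpha> x0 G (Suc t) $ i =
      (\<Sum>j<n. H_mat n \<alpha> G $$ (i, j) * opinion n \<alpha> x0 G t $ j) + (1 - \<alpha> i) * x0 $ i" for t
      using i by (simp add: H_mat_sum[OF G])
  qed (use \<alpha> c x0 G in \<open>simp_all add: H_mat_nonneg H_mat_row_sum\<close>)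
  then obtain y where lim: "\<And>i. i < n \<Longrightarrow> (\<lambda>t. opinion n \<alpha> x0 G t $ i) \<longlonglongrightarrow> y i"
    and y01: "\<And>i. i < n \<Longrightarrow> 0 \<le> y i \<and> y i \<le> 1"
    and fp: "\<And>i. i < n \<Longrightarrow> y i = (\<Sum>j<n. H_mat n \<alpha> G $$ (i, j) * y j) + (1 - \<alpha> i) * x0 $ i"
    by blast
  have eq: "stable_opinion n \<alpha> x0 G $ i = y i" if "i < n" for i
    using that limI[OF lim[OF that]] by (simp add: stable_opinion_def)
  show "0 \<le> stable_opinion n \<alpha> x0 G $ i \<and> stable_opinion n \<alpha> x0 G $ i \<le> 1"
    and "stable_opinion n \<alpha> x0 G $ i =
      (\<Sum>j<n. H_mat n \<alpha> G $$ (i, j) * stable_opinion n \<alpha> x0 G $ j) + (1 - \<alpha> i) * x0 $ i"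
    using y01[OF i] fp[OF i] by (simp_all add: eq i)
qed

text \<open>\<open>pow_mat\<close> appends the new factor on the right, whereas the mean-field
  recursion needs it on the left. Induction with arbitrary \<open>v\<close> moves it across,
  absorbing one factor into the vector.\<close>

lemma pow_mat_Suc_mult_vec:
  fixes A :: "'a :: semiring_1 mat"
  assumes A: "A \<in> carrier_mat n n" and v: "v \<in> carrier_vec n"
  shows "A ^\<^sub>m Suc k *\<^sub>v v = A *\<^sub>v (A ^\<^sub>m k *\<^sub>v v)"
  using v
proof (induction k arbitrary: v)
  case 0
  then show ?case using A by simp
next
  case (Suc k)
  have [simp]: "A ^\<^sub>m k \<in> carrier_mat n n" for k using A by (rule pow_carrier_mat)
  have "A ^\<^sub>m Suc (Suc k) *\<^sub>v v = A ^\<^sub>m Suc k *\<^sub>v (A *\<^sub>v v)"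
    unfolding pow_mat.simps(2)[of A "Suc k"] using A Suc.prems by (intro assoc_mult_mat_vec) auto
  also have "\<dots> = A *\<^sub>v (A ^\<^sub>m k *\<^sub>v (A *\<^sub>v v))"
    using A Suc.prems by (intro Suc.IH) auto
  also have "A ^\<^sub>m k *\<^sub>v (A *\<^sub>v v) = A ^\<^sub>m Suc k *\<^sub>v v"
    using A Suc.prems by (simp add: assoc_mult_mat_vec[of _ n n _ n])
  finally show ?case .
qed

lemma mult_mat_vec_index_sum:
  assumes "A \<in> carrier_mat n n" "v \<in> carrier_vec n" "i < n"
  shows "(A *\<^sub>v v) $ i = (\<Sum>j<n. A $$ (i, j) * v $ j)"
  using assms by (auto simp: scalar_prod_def atLeast0LessThan intro!: sum.cong)

text \<open>Because of its index shift, the mean-field sequence from time 1 on is an affine iteration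
  that starts at \<open>x0\<close>.\<close>

lemma mean_field_rec:
  assumes x0: "x0 \<in> carrier_vec n" and i: "i < n"
  shows "mean_field n p \<alpha> x0 (Suc (Suc t)) $ i =
    (\<Sum>j<n. expected_H n p \<alpha> $$ (i, j) * mean_field n p \<alpha> x0 (Suc t) $ j) + (1 - \<alpha> i) * x0 $ i"
proof -
  let ?Q = "expected_H n p \<alpha>" and ?b = "B_mat n \<alpha> *\<^sub>v x0"
  have Q: "?Q \<in> carrier_mat n n" by (simp add: expected_H_def)
  have b: "?b \<in> carrier_vec n" using x0 by (simp add: B_mat_def mult_mat_vec_carrier[of _ n n])
  have bi: "?b $ i = (1 - \<alpha> i) * x0 $ i"
  proof -
    have "?b $ i = (\<Sum>j<n. B_mat n \<alpha> $$ (i, j) * x0 $ j)"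
      using x0 i by (intro mult_mat_vec_index_sum) (auto simp: B_mat_def)
    also have "\<dots> = (\<Sum>j<n. if i = j then (1 - \<alpha> i) * x0 $ j else 0)"
      using i by (intro sum.cong) (auto simp: B_mat_def mat_diag_def)
    finally show ?thesis using i by simp
  qed
  have pow: "(?Q ^\<^sub>m Suc k *\<^sub>v v) $ i = (\<Sum>j<n. ?Q $$ (i, j) * (?Q ^\<^sub>m k *\<^sub>v v) $ j)"
    if "v \<in> carrier_vec n" for k v
    unfolding pow_mat_Suc_mult_vec[OF Q that]
    using Q i that pow_carrier_mat[OF Q, of k]
    by (intro mult_mat_vec_index_sum mult_mat_vec_carrier[of _ n n]) auto
  have "mean_field n p \<alpha> x0 (Suc (Suc t)) $ i =
      (?Q ^\<^sub>m Suc t *\<^sub>v x0) $ i + (\<Sum>k<Suc t. (?Q ^\<^sub>m k *\<^sub>v ?b) $ i)"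
    using i by simp
  \<comment> \<open>The term \<open>k = 0\<close> is the identity power and yields the constant
    part; every later term contains a factor of the expected matrix that can be pulled out.\<close>
  also have "(\<Sum>k<Suc t. (?Q ^\<^sub>m k *\<^sub>v ?b) $ i) = ?b $ i + (\<Sum>k<t. (?Q ^\<^sub>m Suc k *\<^sub>v ?b) $ i)"
    using b Q unfolding sum.lessThan_Suc_shift by simp
  also have "(\<Sum>k<t. (?Q ^\<^sub>m Suc k *\<^sub>v ?b) $ i)
      = (\<Sum>j<n. ?Q $$ (i, j) * (\<Sum>k<t. (?Q ^\<^sub>m k *\<^sub>v ?b) $ j))"
    unfolding pow[OF b] sum_distrib_left by (rule sum.swap)
  finally show ?thesis
    unfolding pow[OF x0] bi by (simp add: distrib_left sum.distrib)
qed

lemma stable_mean_field_fixed_point: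
  assumes x0: "x0 \<in> carrier_vec n" and c: "0 \<le> c" "c < 1"
    and \<alpha>: "\<And>i. i < n \<Longrightarrow> 0 \<le> \<alpha> i \<and> \<alpha> i \<le> c"
    and x01: "\<And>i. i < n \<Longrightarrow> 0 \<le> x0 $ i \<and> x0 $ i \<le> 1"
    and i: "i < n"
  shows "0 \<le> stable_mean_field n p \<alpha> x0 $ i \<and> stable_mean_field n p \<alpha> x0 $ i \<le> 1"
    and "stable_mean_field n p \<alpha> x0 $ i =
      (\<Sum>j<n. expected_H n p \<alpha> $$ (i, j) * stable_mean_field n p \<alpha> x0 $ j) + (1 - \<alpha> i) * x0 $ i"
proof -
  have Q: "expected_H n p \<alpha> \<in> carrier_mat n n" by (simp add: expected_H_def)
  have "\<exists>y. \<forall>i<n. (\<lambda>t. mean_field n p \<alpha> x0 (Suc t) $ i) \<longlonglongrightarrow> y i \<and> 0 \<le> y i \<and> y i \<le> 1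
      \<and> y i = (\<Sum>j<n. expected_H n p \<alpha> $$ (i, j) * y j) + (1 - \<alpha> i) * x0 $ i"
  proof (rule affine_iteration_converges[where n = n and K = "\<lambda>i j. expected_H n p \<alpha> $$ (i, j)"
        and a = \<alpha> and b = "\<lambda>i. (1 - \<alpha> i) * x0 $ i" and c = c
        and u = "\<lambda>t i. mean_field n p \<alpha> x0 (Suc t) $ i"])
    fix i assume i: "i < n"
    show "0 \<le> (1 - \<alpha> i) * x0 $ i \<and> (1 - \<alpha> i) * x0 $ i \<le> 1 - \<alpha> i"
      using \<alpha>[OF i] x01[OF i] c by (auto intro: mult_left_le)
    \<comment> \<open>At time 1 only the zeroth power occurs and the sum is empty, so the shifted
      iteration starts at \<open>x0\<close>.\<close>
    show "0 \<le> mean_field n p \<alpha> x0 (Suc 0) $ i \<and> mean_field n p \<alpha> x0 (Suc 0) $ i \<le> 1"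
      using i x0 x01[OF i] Q by simp
    show "mean_field n p \<alpha> x0 (Suc (Suc t)) $ i =
      (\<Sum>j<n. expected_H n p \<alpha> $$ (i, j) * mean_field n p \<alpha> x0 (Suc t) $ j) + (1 - \<alpha> i) * x0 $ i" for t
      by (rule mean_field_rec[OF x0 i])
  qed (use \<alpha> c in \<open>simp_all add: expected_H_nonneg expected_H_row_sum\<close>)
  then obtain y where lim: "\<And>i. i < n \<Longrightarrow> (\<lambda>t. mean_field n p \<alpha> x0 (Suc t) $ i) \<longlonglongrightarrow> y i"
    and y01: "\<And>i. i < n \<Longrightarrow> 0 \<le> y i \<and> y i \<le> 1"
    and fp: "\<And>i. i < n \<Longrightarrow> y i = (\<Sum>j<n. expected_H n p \<alpha> $$ (i, j) * y j) + (1 - \<alpha> i) * x0 $ i"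
    by blast
  have eq: "stable_mean_field n p \<alpha> x0 $ i = y i" if "i < n" for i
    using that limI[OF LIMSEQ_imp_Suc[OF lim[OF that]]] by (simp add: stable_mean_field_def)
  show "0 \<le> stable_mean_field n p \<alpha> x0 $ i \<and> stable_mean_field n p \<alpha> x0 $ i \<le> 1"
    and "stable_mean_field n p \<alpha> x0 $ i =
      (\<Sum>j<n. expected_H n p \<alpha> $$ (i, j) * stable_mean_field n p \<alpha> x0 $ j) + (1 - \<alpha> i) * x0 $ i"
    using y01[OF i] fp[OF i] by (simp_all add: eq i)
qed

subsection \<open>Comparison of the two fixed points\<close>

text \<open>A row average is a ratio of two random sums. Concentration is applied to the degree
  (weights 1) and to the centred weights \<open>v j - m\<close>. Outside both bad events the degree
  exceeds M/2 and the centred sum is below \<epsilon> M, where M is the expected degree, so the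
  ratio is at most 2\<epsilon>. Two two-sided bounds give the factor 4.\<close>

lemma H_mat_sum_concentration:
  fixes v :: "nat \<Rightarrow> real"
  assumes p: "0 < p" "p \<le> 1" and i: "i < n" and n: "2 \<le> n" and \<epsilon>: "0 < \<epsilon>" "\<epsilon> \<le> 1 / 2"
    and \<alpha>: "0 \<le> \<alpha> i" "\<alpha> i \<le> 1" and v: "\<And>j. j < n \<Longrightarrow> 0 \<le> v j \<and> v j \<le> 1"
  defines "m \<equiv> (\<Sum>j\<in>{..<n} - {i}. v j) / real (n - 1)"
  shows "0 \<le> m" "m \<le> 1"
    and "measure_pmf.prob (erdos_renyi n p)
      {G. G \<subseteq> possible_edges n \<and> \<bar>(\<Sum>j<n. H_mat n \<alpha> G $$ (i, j) * v j) - \<alpha> i * m\<bar> > 2 * \<epsilon>}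
      \<le> 4 * exp (- \<epsilon>\<^sup>2 * (real (n - 1) * p) / 4)"
proof -
  let ?J = "{..<n} - {i}" and ?M = "real (n - 1) * p" and ?P = "erdos_renyi n p"
  let ?e = "exp (- \<epsilon>\<^sup>2 * ?M / 4)"
  have M: "0 < ?M" using n p by simp
  show m0: "0 \<le> m" unfolding m_def using v by (intro divide_nonneg_nonneg sum_nonneg) auto
  have "(\<Sum>j\<in>?J. v j) \<le> (\<Sum>j\<in>?J. 1)" using v by (intro sum_mono) auto
  then show m1: "m \<le> 1" using n i by (simp add: m_def field_simps)
  let ?A = "{G. G \<subseteq> possible_edges n \<and> \<bar>(\<Sum>j<n. H_mat n \<alpha> G $$ (i, j) * v j) - \<alpha> i * m\<bar> > 2 * \<epsilon>}"
  let ?B = "\<lambda>u. {G. \<bar>(\<Sum>j\<in>neighbours G i. u j) - p * (\<Sum>j\<in>?J. u j)\<bar> \<ge> \<epsilon> * ?M}"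
  \<comment> \<open>\<open>m\<close> is the mean over the nodes other than \<open>i\<close>, so the
    centred sum has expectation 0 and its deviation is its absolute value.\<close>
  have centred: "(\<Sum>j\<in>?J. v j - m) = 0"
    using n i by (simp add: sum_subtractf m_def)
  have "?A \<subseteq> ?B (\<lambda>_. 1) \<union> ?B (\<lambda>j. v j - m)"
  proof (rule subsetI, rule ccontr)
    fix G assume A: "G \<in> ?A" and "G \<notin> ?B (\<lambda>_. 1) \<union> ?B (\<lambda>j. v j - m)"
    then have D: "\<bar>real (node_degree G i) - ?M\<bar> < \<epsilon> * ?M"
      and S: "\<bar>\<Sum>j\<in>neighbours G i. v j - m\<bar> < \<epsilon> * ?M"
      using i centred by (auto simp: node_degree_def mult.commute)
    \<comment> \<open>Here \<open>\<epsilon> \<le> 1 / 2\<close> enters: the degree stays above half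
      its mean, so in particular \<open>i\<close> is not isolated.\<close>
    have "\<epsilon> * ?M \<le> 1 / 2 * ?M" using \<epsilon>(2) less_imp_le[OF M] by (rule mult_right_mono)
    with D have D2: "?M / 2 < real (node_degree G i)" by linarith
    with M have "0 < real (node_degree G i)" by linarith
    then have D0: "0 < node_degree G i" by simp
    have "(\<Sum>j<n. H_mat n \<alpha> G $$ (i, j) * v j) - \<alpha> i * m
        = \<alpha> i * ((\<Sum>j\<in>neighbours G i. v j - m) / real (node_degree G i))"
      using A D0 i H_mat_sum[of G n i \<alpha> v]
      by (simp add: sum_subtractf node_degree_def right_diff_distrib diff_divide_distrib)
    also have "\<bar>\<dots>\<bar> \<le> \<bar>(\<Sum>j\<in>neighbours G i. v j - m) / real (node_degree G i)\<bar>"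
      unfolding abs_mult using \<alpha> by (intro mult_left_le_one_le) auto
    also have "\<dots> \<le> \<epsilon> * ?M / (?M / 2)"
      unfolding abs_divide
    proof (rule frac_le)
      show "0 \<le> \<epsilon> * ?M" using \<epsilon>(1) M by (intro mult_nonneg_nonneg less_imp_le)
      show "\<bar>\<Sum>j\<in>neighbours G i. v j - m\<bar> \<le> \<epsilon> * ?M" using S by (rule less_imp_le)
      show "0 < ?M / 2" using M by (rule half_gt_zero)
      show "?M / 2 \<le> \<bar>real (node_degree G i)\<bar>" using D2 by linarith
    qed
    also have "\<dots> = 2 * \<epsilon>" using p n by simp
    finally show False using A by simp
  qed
  then have "measure_pmf.prob ?P ?A \<le> measure_pmf.prob ?P (?B (\<lambda>_. 1) \<union> ?B (\<lambda>j. v j - m))"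
    by (intro measure_pmf.finite_measure_mono) auto
  also have "\<dots> \<le> measure_pmf.prob ?P (?B (\<lambda>_. 1)) + measure_pmf.prob ?P (?B (\<lambda>j. v j - m))"
    by (rule measure_Un_le) auto
  also have "\<dots> \<le> 2 * ?e + 2 * ?e"
  proof (intro add_mono erdos_renyi_concentration)
    show "\<bar>v j - m\<bar> \<le> 1" if "j < n" for j using v[OF that] m0 m1 by auto
  qed (use p i \<epsilon> in auto)
  finally show "measure_pmf.prob ?P ?A \<le> 4 * ?e" by simp
qed

text \<open>A bound for fixed \<open>n\<close>. On good graphs both \<open>H y\<close> and its
  expectation are near \<alpha>(i) m(i), with errors 2\<epsilon> and 2\<epsilon> + \<eta>, and the
  fixed-point comparison divides the total by \<open>1 - c\<close>. Bad graphs have probability at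
  most \<eta> and cost at most 1 each, as all opinions lie in [0,1].\<close>

lemma expected_opinion_mean_field_close:
  assumes p: "0 < p" "p \<le> 1" and n: "2 \<le> n" and \<epsilon>: "0 < \<epsilon>" "\<epsilon> \<le> 1 / 2"
    and c: "0 \<le> c" "c < 1" and x0: "x0 \<in> carrier_vec n"
    and \<alpha>: "\<And>i. i < n \<Longrightarrow> 0 \<le> \<alpha> i \<and> \<alpha> i \<le> c"
    and x01: "\<And>i. i < n \<Longrightarrow> 0 \<le> x0 $ i \<and> x0 $ i \<le> 1"
    and i: "i < n"
  defines "\<eta> \<equiv> 4 * real n * exp (- \<epsilon>\<^sup>2 * (real (n - 1) * p) / 4)"
  shows "\<bar>expected_stable_opinion n p \<alpha> x0 $ i - stable_mean_field n p \<alpha> x0 $ i\<bar>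
    \<le> (4 * \<epsilon> + \<eta>) / (1 - c) + \<eta>"
proof -
  let ?P = "erdos_renyi n p"
  define y where "y i = stable_mean_field n p \<alpha> x0 $ i" for i
  define x where "x G i = stable_opinion n \<alpha> x0 G $ i" for G i
  define m where "m i = (\<Sum>j\<in>{..<n} - {i}. y j) / real (n - 1)" for i
  define Hy where "Hy G i = (\<Sum>j<n. H_mat n \<alpha> G $$ (i, j) * y j)" for G i
  define A where "A i = {G. G \<subseteq> possible_edges n \<and> \<bar>Hy G i - \<alpha> i * m i\<bar> > 2 * \<epsilon>}" for i
  \<comment> \<open>One exceptional event serves all nodes at once; the union bound is the source of
    the factor \<open>real n\<close> in \<eta>.\<close>
  define Bad where "Bad = (\<Union>i<n. A i)"
  have \<alpha>1: "0 \<le> \<alpha> i" "\<alpha> i \<le> 1" if "i < n" for i using \<alpha>[OF that] c by auto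
  have y01: "0 \<le> y i \<and> y i \<le> 1" if "i < n" for i
    unfolding y_def by (rule stable_mean_field_fixed_point(1)[OF x0 c]) (use \<alpha> x01 that in auto)
  have y_fp: "y i = (\<Sum>j<n. expected_H n p \<alpha> $$ (i, j) * y j) + (1 - \<alpha> i) * x0 $ i"
    if "i < n" for i
    unfolding y_def by (rule stable_mean_field_fixed_point(2)[OF x0 c]) (use \<alpha> x01 that in auto)
  have x01': "0 \<le> x G i \<and> x G i \<le> 1" if "G \<subseteq> possible_edges n" "i < n" for G i
    unfolding x_def by (rule stable_opinion_fixed_point(1)[OF _ c]) (use \<alpha> x01 that in auto)
  have x_fp: "x G i = (\<Sum>j<n. H_mat n \<alpha> G $$ (i, j) * x G j) + (1 - \<alpha> i) * x0 $ i"
    if "G \<subseteq> possible_edges n" "i < n" for G i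
    unfolding x_def by (rule stable_opinion_fixed_point(2)[OF _ c]) (use \<alpha> x01 that in auto)
  have m01: "0 \<le> m i" "m i \<le> 1"
    and prob_A: "measure_pmf.prob ?P (A i) \<le> 4 * exp (- \<epsilon>\<^sup>2 * (real (n - 1) * p) / 4)"
    if "i < n" for i
    unfolding m_def A_def Hy_def
    by (rule H_mat_sum_concentration[where \<alpha> = \<alpha>, OF p that n \<epsilon> \<alpha>1[OF that] y01]; assumption)+
  have subset: "G \<subseteq> possible_edges n" if "G \<in> set_pmf ?P" for G
    using that set_erdos_renyi_subset by blast
  have "measure_pmf.prob ?P Bad \<le> (\<Sum>i<n. measure_pmf.prob ?P (A i))"
    unfolding Bad_def by (intro measure_UNION_le) auto
  also have "\<dots> \<le> (\<Sum>i<n. 4 * exp (- \<epsilon>\<^sup>2 * (real (n - 1) * p) / 4))"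
    by (intro sum_mono prob_A) auto
  also have "\<dots> = \<eta>" unfolding sum_constant \<eta>_def by simp
  finally have bad: "measure_pmf.prob ?P Bad \<le> \<eta>" .
  have good: "\<bar>Hy G i - \<alpha> i * m i\<bar> \<le> 2 * \<epsilon>" if "G \<in> set_pmf ?P" "G \<notin> Bad" "i < n" for G i
    using that subset[of G] by (auto simp: Bad_def A_def not_less)
  \<comment> \<open>The expected matrix applied to the deterministic \<open>y\<close> is the
    expectation of \<open>Hy\<close>, so its error is that on good graphs plus the probability of
    \<open>Bad\<close>.\<close>
  have Q: "\<bar>(\<Sum>j<n. expected_H n p \<alpha> $$ (i, j) * y j) - \<alpha> i * m i\<bar> \<le> 2 * \<epsilon> + \<eta>" if i: "i < n" for i
  proof -
    have "\<bar>Hy G i - \<alpha> i * m i\<bar> \<le> 1" if G: "G \<in> set_pmf ?P" for G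
    proof -
      have "0 \<le> Hy G i" "Hy G i \<le> 1"
        unfolding Hy_def using H_mat_sum_bounds[where \<alpha> = \<alpha>, OF subset[OF G] i \<alpha>1[OF i] y01] by auto
      moreover have "0 \<le> \<alpha> i * m i" "\<alpha> i * m i \<le> 1"
        using \<alpha>1[OF i] m01[OF i] by (auto intro: mult_le_one)
      ultimately show ?thesis by linarith
    qed
    then have "\<bar>measure_pmf.expectation ?P (\<lambda>G. Hy G i - \<alpha> i * m i)\<bar> \<le> 2 * \<epsilon> + measure_pmf.prob ?P Bad"
      using \<epsilon> good i by (intro abs_expectation_le_bad_event finite_set_erdos_renyi) auto
    moreover have "measure_pmf.expectation ?P (\<lambda>G. Hy G i - \<alpha> i * m i)
        = measure_pmf.expectation ?P (\<lambda>G. Hy G i) - \<alpha> i * m i" by simp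
    ultimately show ?thesis
      using bad unfolding expected_H_sum[OF i] Hy_def by linarith
  qed
  have \<eta>: "0 \<le> \<eta>" by (simp add: \<eta>_def)
  have close: "\<bar>x G i - y i\<bar> \<le> (4 * \<epsilon> + \<eta>) / (1 - c)" if G: "G \<in> set_pmf ?P" "G \<notin> Bad" for G
  proof (rule affine_fixed_points_close[where n = n and K = "\<lambda>i j. H_mat n \<alpha> G $$ (i, j)"
        and L = "\<lambda>i j. expected_H n p \<alpha> $$ (i, j)" and b = "\<lambda>i. (1 - \<alpha> i) * x0 $ i"])
    fix i assume i: "i < n"
    show "x G i = (\<Sum>j<n. H_mat n \<alpha> G $$ (i, j) * x G j) + (1 - \<alpha> i) * x0 $ i"
      by (rule x_fp[OF subset[OF G(1)] i])
    show "y i = (\<Sum>j<n. expected_H n p \<alpha> $$ (i, j) * y j) + (1 - \<alpha> i) * x0 $ i"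
      by (rule y_fp[OF i])
    show "(\<Sum>j<n. H_mat n \<alpha> G $$ (i, j)) \<le> c"
      using H_mat_row_sum[OF subset[OF G(1)] i, of \<alpha>] \<alpha>[OF i] by simp
    show "\<bar>(\<Sum>j<n. H_mat n \<alpha> G $$ (i, j) * y j) - (\<Sum>j<n. expected_H n p \<alpha> $$ (i, j) * y j)\<bar> \<le> 4 * \<epsilon> + \<eta>"
      using good[OF G i] Q[OF i] unfolding Hy_def by linarith
  qed (use c i \<alpha>1 in \<open>auto intro: H_mat_nonneg\<close>)
  have "\<bar>measure_pmf.expectation ?P (\<lambda>G. x G i - y i)\<bar>
      \<le> (4 * \<epsilon> + \<eta>) / (1 - c) + measure_pmf.prob ?P Bad"
  proof (intro abs_expectation_le_bad_event finite_set_erdos_renyi close)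
    show "\<bar>x G i - y i\<bar> \<le> 1" if "G \<in> set_pmf ?P" for G
      using x01'[OF subset[OF that] i] y01[OF i] by (simp add: abs_le_iff)
  qed (use \<epsilon> \<eta> c in auto)
  also have "measure_pmf.expectation ?P (\<lambda>G. x G i - y i)
      = expected_stable_opinion n p \<alpha> x0 $ i - y i"
    using i by (simp add: expected_stable_opinion_def x_def)
  finally show ?thesis using bad by (simp add: y_def)
qed

section \<open>Passage to the limit\<close>

lemma linf_norm_le:
  assumes "0 \<le> r" "\<And>i. i < dim_vec v \<Longrightarrow> \<bar>v $ i\<bar> \<le> r"
  shows "linf_norm v \<le> r"
  using assms by (auto simp: linf_norm_def)

lemma linf_norm_nonneg: "0 \<le> linf_norm v"
  by (simp add: linf_norm_def)

text \<open>The exponent must reach \<open>2 * ln (real n)\<close>, so that n times n^(-2) tends to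
  0. The constant 16 is this 2 times the 4 in the exponent times the 2 lost in
  \<open>real (n - 1) \<ge> real n / 2\<close>.\<close>

lemma chernoff_error_eventually_small:
  fixes p :: "nat \<Rightarrow> real"
  assumes "filterlim (\<lambda>n. p n / (ln (real n) / real n)) at_top sequentially" and \<epsilon>: "0 < \<epsilon>"
  shows "\<forall>\<^sub>F n in sequentially. 4 * real n * exp (- \<epsilon>\<^sup>2 * (real (n - 1) * p n) / 4) \<le> 4 / real n"
proof -
  have "\<forall>\<^sub>F n in sequentially. 16 / \<epsilon>\<^sup>2 \<le> p n / (ln (real n) / real n)"
    using assms(1) by (auto simp: filterlim_at_top)
  with eventually_ge_at_top[of 2] show ?thesis
  proof eventually_elim
    case (elim n)
    have ln: "0 < ln (real n)" using elim by simp
    have *: "16 / \<epsilon>\<^sup>2 * ln (real n) \<le> real n * p n"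
      using elim ln by (simp add: field_simps)
    \<comment> \<open>The sign of \<open>p n\<close> is read off from the growth bound.\<close>
    have "0 \<le> 16 / \<epsilon>\<^sup>2 * ln (real n)" using ln by simp
    with * have "0 \<le> real n * p n" by linarith
    then have "0 \<le> p n" using elim by (simp add: zero_le_mult_iff)
    then have "real n / 2 * p n \<le> real (n - 1) * p n"
      using elim by (intro mult_right_mono) auto
    with * have "8 / \<epsilon>\<^sup>2 * ln (real n) \<le> real (n - 1) * p n" by simp
    then have "8 * ln (real n) \<le> \<epsilon>\<^sup>2 * (real (n - 1) * p n)"
      using \<epsilon> by (simp add: field_simps)
    then have "exp (- \<epsilon>\<^sup>2 * (real (n - 1) * p n) / 4) \<le> exp (- (2 * ln (real n)))"
      by simp
    also have "\<dots> = 1 / (real n)\<^sup>2"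
      using elim by (simp add: exp_minus exp_double field_simps)
    finally have "4 * real n * exp (- \<epsilon>\<^sup>2 * (real (n - 1) * p n) / 4) \<le> 4 * real n * (1 / (real n)\<^sup>2)"
      by (intro mult_left_mono) auto
    also have "\<dots> = 4 / real n" by (simp add: power2_eq_square)
    finally show ?case .
  qed
qed

theorem theorem3p5:
  fixes p :: "nat \<Rightarrow> real"
    and \<alpha> :: "nat \<Rightarrow> nat \<Rightarrow> real"
    and x0 :: "nat \<Rightarrow> real vec"
  assumes "\<And>n. n \<ge> 1 \<Longrightarrow> 0 < p n \<and> p n < 1"
    and "filterlim (\<lambda>n. p n / (ln (real n) / real n)) at_top sequentially"
    and "\<And>n. x0 n \<in> carrier_vec n"
    and "\<And>n i. i < n \<Longrightarrow> 0 \<le> x0 n $ i \<and> x0 n $ i \<le> 1"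
    and "\<And>n i. i < n \<Longrightarrow> 0 \<le> \<alpha> n i \<and> \<alpha> n i \<le> 1"
    and "\<exists>\<alpha>bar. 0 < \<alpha>bar \<and> \<alpha>bar < 1 \<and> (\<forall>n. \<forall>i<n. \<alpha> n i \<le> \<alpha>bar)"
  shows "(\<lambda>n. linf_norm (expected_stable_opinion n (p n) (\<alpha> n) (x0 n)
                        - stable_mean_field n (p n) (\<alpha> n) (x0 n))) \<longlonglongrightarrow> 0"
proof (rule LIMSEQ_I)
  fix r :: real assume r: "0 < r"
  obtain c where c: "0 < c" "c < 1" "\<And>n i. i < n \<Longrightarrow> \<alpha> n i \<le> c" using assms(6) by blast
  \<comment> \<open>The second entry makes the \<epsilon>-part of the error at most r/4, and the
    first is the range in which the concentration bound holds. The \<eta>-part takes another r/4,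
    leaving r/2 < r.\<close>
  define \<epsilon> where "\<epsilon> = min (1 / 2) (r * (1 - c) / 16)"
  have \<epsilon>: "0 < \<epsilon>" "\<epsilon> \<le> 1 / 2" and \<epsilon>r: "4 * \<epsilon> / (1 - c) \<le> r / 4"
    using r c by (auto simp: \<epsilon>_def field_simps min_def)
  have "(\<lambda>n. (4 / real n) / (1 - c) + 4 / real n) \<longlonglongrightarrow> 0 / (1 - c) + 0"
    using c by (intro tendsto_intros lim_const_over_n) auto
  then have "\<forall>\<^sub>F n in sequentially. (4 / real n) / (1 - c) + 4 / real n < r / 4"
    using r by (intro order_tendstoD(2)[where y = 0]) auto
  with chernoff_error_eventually_small[OF assms(2) \<epsilon>(1)] eventually_ge_at_top[of 2]
  have "\<forall>\<^sub>F n in sequentially. norm (linf_norm (expected_stable_opinion n (p n) (\<alpha> n) (x0 n)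
      - stable_mean_field n (p n) (\<alpha> n) (x0 n)) - 0) < r"
  proof eventually_elim
    case (elim n)
    let ?v = "expected_stable_opinion n (p n) (\<alpha> n) (x0 n) - stable_mean_field n (p n) (\<alpha> n) (x0 n)"
    let ?\<eta> = "4 * real n * exp (- \<epsilon>\<^sup>2 * (real (n - 1) * p n) / 4)"
    have "(4 * \<epsilon> + ?\<eta>) / (1 - c) + ?\<eta> \<le> (4 * \<epsilon> + 4 / real n) / (1 - c) + 4 / real n"
      using elim c by (intro add_mono divide_right_mono) auto
    also have "\<dots> \<le> r / 2"
      using elim \<epsilon>r by (simp add: add_divide_distrib)
    finally have bound: "(4 * \<epsilon> + ?\<eta>) / (1 - c) + ?\<eta> \<le> r / 2" .
    have "linf_norm ?v \<le> r / 2"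
    proof (rule linf_norm_le)
      fix i assume "i < dim_vec ?v"
      then have i: "i < n" by (simp add: stable_mean_field_def)
      have "\<bar>expected_stable_opinion n (p n) (\<alpha> n) (x0 n) $ i - stable_mean_field n (p n) (\<alpha> n) (x0 n) $ i\<bar>
          \<le> (4 * \<epsilon> + ?\<eta>) / (1 - c) + ?\<eta>"
        using assms(1)[of n] elim assms(3,4,5) c i \<epsilon>
        by (intro expected_opinion_mean_field_close) auto
      also note bound
      finally show "\<bar>?v $ i\<bar> \<le> r / 2"
        using i by (simp add: stable_mean_field_def)
    qed (use r in simp)
    then show ?case using linf_norm_nonneg[of ?v] r by simp
  qed
  then show "\<exists>N. \<forall>n\<ge>N. norm (linf_norm (expected_stable_opinion n (p n) (\<alpha> n) (x0 n)
      - stable_mean_field n (p n) (\<alpha> n) (x0 n)) - 0) < r"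
    by (simp add: eventually_sequentially)
qed

end
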